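(* Let $X,X_1,X_2,\ldots$ be i.i.d. with distribution $F$ having density $f$, let $G$ be another distribution with density $g$ (both with respect to the same reference measure $\mu$), and let $\{W_n\}$ be the CUSUM process generated by the log-likelihood ratios $Y_i=\log\frac{g(X_i)}{f(X_i)}$. Put $$D_{F,G}=\mathbb{P}_F\{f(X)>g(X)\}-\mathbb{P}_G\{f(X)>g(X)\}.$$ Then for every $n\ge1$ and every $h$, $$\mathbb{P}_F\Bigl\{\max_{0\le t\le n}W_t\ge h\Bigr\}\le e^{-h}\bigl(1+nD_{F,G}\bigr).$$ Consequently, for any $\alpha\in(0,1)$, the threshold $h_\alpha=\log\frac{1+nD_{F,G}}{\alpha}$ guarantees $$\mathbb{P}_F\Bigl\{\max_{0\le t\le n}W_t\ge h_\alpha\Bigr\}\le\alpha .$$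
   Context: The CUSUM process based on $Y_1,Y_2,\ldots$ is defined by $W_0=0$ and $W_{n+1}=\max\{W_n+Y_{n+1},0\}$. $\mathbb{P}_F$ (resp. $\mathbb{P}_G$) denotes probability when the observations are i.i.d. from $F$ (resp. $G$), and $\mathbb{E}_F$ is expectation under $\mathbb{P}_F$. The log-likelihood ratios are taken to be well defined real random variables under $F$ with $\mathbb{E}_F e^{Y_i}=\int g\,d\mu=1$. *)

theory Defs
  imports "HOL-Probability.Probability"
begin

text \<open>The increments are \<open>y 1, y 2, \<dots>\<close>; the value \<open>y 0\<close> is never used.\<close>

primrec cusum :: "(nat \<Rightarrow> real) \<Rightarrow> nat \<Rightarrow> real" where
  "cusum y 0 = 0"
| "cusum y (Suc n) = max (cusum y n + y (Suc n)) 0"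

text \<open>The arguments \<open>f\<close> and \<open>g\<close> are the densities of the pre-change law \<open>F\<close> and the
  post-change law \<open>G\<close>, in this order. The value is meaningful only where both are positive.\<close>

definition llr :: "('a \<Rightarrow> real) \<Rightarrow> ('a \<Rightarrow> real) \<Rightarrow> 'a \<Rightarrow> real" where
  "llr f g x = ln (g x / f x)"

text \<open>Since \<open>X\<close> has law \<open>F\<close> (resp. \<open>G\<close>), the probability that \<open>f X > g X\<close> is the mass
  that this law itself gives to the set where \<open>f > g\<close>.\<close>

definition D_FG :: "'a measure \<Rightarrow> 'a measure \<Rightarrow> ('a \<Rightarrow> real) \<Rightarrow> ('a \<Rightarrow> real) \<Rightarrow> real" where
  "D_FG F G f g = \<P>(x in F. f x > g x) - \<P>(x in G. f x > g x)"

end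

theory Submission imports Defs begin

text \<open>Let \<open>L = e\<^sup>Y\<close> and freeze the CUSUM process at its first passage above \<open>h\<close>; call the frozen
  process \<open>V\<close>. Then \<open>max W\<^sub>t \<ge> h\<close> up to time \<open>n\<close> exactly when \<open>V\<^sub>n \<ge> h\<close>. Since \<open>a = e\<^sup>V\<close> is at
  least \<open>1\<close>, \<open>max (a L) 1 \<le> a L + (1 - L)\<^sup>+\<close>; as \<open>L\<close> has mean \<open>1\<close> and is independent of the past,
  one step increases the mean of \<open>e\<^sup>V\<close> by at most \<open>E (1 - L)\<^sup>+\<close>, which is \<open>D\<^sub>F\<^sub>G\<close> by a change of measure.
  Markov's inequality for \<open>e\<^sup>V\<close> at time \<open>n\<close> gives the bound.\<close>

primrec stopped_cusum :: "real \<Rightarrow> (nat \<Rightarrow> real) \<Rightarrow> nat \<Rightarrow> real" where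
  "stopped_cusum h y 0 = 0"
| "stopped_cusum h y (Suc n) =
     (if h \<le> stopped_cusum h y n then stopped_cusum h y n
      else max (stopped_cusum h y n + y (Suc n)) 0)"

lemma stopped_cusum_nonneg: "0 \<le> stopped_cusum h y n"
  by (induction n) auto

text \<open>The value at time \<open>n\<close> sees only the coordinates \<open>1\<close> to
  \<open>n\<close>; this lets it factor through a restriction to \<open>{1..n}\<close> in the
  independence argument.\<close>

lemma stopped_cusum_cong:
  "(\<And>i. i \<in> {1..n} \<Longrightarrow> y i = z i) \<Longrightarrow> stopped_cusum h y n = stopped_cusum h z n"
  by (induction n) auto

text \<open>Once frozen, the process stays at or above \<open>h\<close>. A value below
  \<open>h\<close> thus means that no freezing has occurred and both recursions agreed so
  far.\<close>

lemma stopped_cusum_eq_cusum: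
  "stopped_cusum h y n < h \<Longrightarrow> stopped_cusum h y n = cusum y n"
  by (induction n) (auto split: if_splits)

text \<open>A frozen process keeps both sides true. Otherwise no earlier time qualifies and the next
  step is still the CUSUM step, so only time \<open>Suc n\<close> matters. For
  \<open>h \<le> 0\<close> freezing occurs at time \<open>0\<close>.\<close>

lemma le_stopped_cusum_iff: "h \<le> stopped_cusum h y n \<longleftrightarrow> (\<exists>t\<le>n. h \<le> cusum y t)"
proof (induction n)
  case (Suc n)
  show ?case
  proof (cases "h \<le> stopped_cusum h y n")
    case True
    with Suc show ?thesis by (auto intro: le_SucI)
  next
    case False
    then have "stopped_cusum h y (Suc n) = cusum y (Suc n)"
      using stopped_cusum_eq_cusum[of h y n] by simp
    with False Suc show ?thesis by (auto simp: le_Suc_eq simp del: stopped_cusum.simps cusum.simps)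
  qed
qed simp

lemma le_Max_cusum_iff: "h \<le> (MAX t\<in>{0..n}. cusum y t) \<longleftrightarrow> h \<le> stopped_cusum h y n"
  by (subst Max_ge_iff) (auto simp: le_stopped_cusum_iff)

text \<open>Asking only for the coordinates in \<open>{1..n}\<close> lets the lemma serve both the
  finite product space and the original one, where nothing is known about index
  \<open>0\<close>.\<close>

lemma measurable_stopped_cusum [measurable (raw)]:
  assumes "\<And>i. i \<in> {1..n} \<Longrightarrow> (\<lambda>x. y x i) \<in> borel_measurable M"
  shows "(\<lambda>x. stopped_cusum h (y x) n) \<in> borel_measurable M"
  using assms
proof (induction n)
  case (Suc n)
  have [measurable]: "(\<lambda>x. stopped_cusum h (y x) n) \<in> borel_measurable M"
    using Suc by simp
  have [measurable]: "(\<lambda>x. y x (Suc n)) \<in> borel_measurable M"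
    using Suc.prems by simp
  show ?case by simp
qed simp

text \<open>The left side equals \<open>a * l + max (1 - a * l) 0\<close>, and
  \<open>l \<le> a * l\<close> because \<open>1 \<le> a\<close>.\<close>

lemma max_one_mult_le:
  fixes a l :: real
  assumes "1 \<le> a" "0 \<le> l"
  shows "max (a * l) 1 \<le> a * l + max (1 - l) 0"
  using mult_right_mono[OF assms] by auto

context prob_space
begin

text \<open>The two variables are functions of the disjoint index blocks \<open>{1..n}\<close> and
  \<open>{Suc n}\<close>.\<close>

lemma indep_var_stopped_cusum:
  fixes Y :: "nat \<Rightarrow> 'a \<Rightarrow> real"
  assumes "indep_vars (\<lambda>_. borel) Y {1..}"
  shows "indep_var borel (\<lambda>\<omega>. stopped_cusum h (\<lambda>i. Y i \<omega>) n) borel (Y (Suc n))"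
proof -
  let ?R = "\<lambda>A \<omega>. restrict (\<lambda>i. Y i \<omega>) A"
  have "indep_var (PiM {1..n} (\<lambda>_. borel)) (?R {1..n}) (PiM {Suc n} (\<lambda>_. borel)) (?R {Suc n})"
    by (rule indep_var_restrict[OF assms]) auto
  then have "indep_var borel ((\<lambda>y. stopped_cusum h y n) \<circ> ?R {1..n})
      borel ((\<lambda>y. y (Suc n)) \<circ> ?R {Suc n})"
    by (rule indep_var_compose) (auto intro!: measurable_stopped_cusum)
  moreover have "(\<lambda>y. stopped_cusum h y n) \<circ> ?R {1..n} = (\<lambda>\<omega>. stopped_cusum h (\<lambda>i. Y i \<omega>) n)"
    by (auto simp: fun_eq_iff intro!: stopped_cusum_cong)
  moreover have "(\<lambda>y. y (Suc n)) \<circ> ?R {Suc n} = Y (Suc n)"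
    by (auto simp: fun_eq_iff)
  ultimately show ?thesis by simp
qed

text \<open>Integrability is carried through the induction: the integral of a non-integrable
  function is \<open>0\<close> by convention, so the bound on the mean alone would say
  nothing.\<close>

lemma expectation_exp_stopped_cusum:
  fixes Y :: "nat \<Rightarrow> 'a \<Rightarrow> real"
  assumes indep: "indep_vars (\<lambda>_. borel) Y {1..}"
    and exp1: "\<And>i. i \<ge> 1 \<Longrightarrow> expectation (\<lambda>\<omega>. exp (Y i \<omega>)) = 1"
    and defect: "\<And>i. i \<ge> 1 \<Longrightarrow> expectation (\<lambda>\<omega>. max (1 - exp (Y i \<omega>)) 0) \<le> d"
  shows "integrable M (\<lambda>\<omega>. exp (stopped_cusum h (\<lambda>i. Y i \<omega>) n)) \<and>
    expectation (\<lambda>\<omega>. exp (stopped_cusum h (\<lambda>i. Y i \<omega>) n)) \<le> 1 + real n * d"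
proof (induction n)
  case 0
  show ?case by (simp add: prob_space)
next
  case (Suc n)
  have Y[measurable]: "Y i \<in> borel_measurable M" if "i \<ge> 1" for i
    using indep that unfolding indep_vars_def by auto
  have V[measurable]: "(\<lambda>\<omega>. stopped_cusum h (\<lambda>i. Y i \<omega>) k) \<in> borel_measurable M" for k
    by (rule measurable_stopped_cusum) (simp add: Y)
  define V where "V = (\<lambda>\<omega>. stopped_cusum h (\<lambda>i. Y i \<omega>) n)"
  define L where "L = (\<lambda>\<omega>. exp (Y (Suc n) \<omega>))"
  \<comment> \<open>\<open>A\<close> is the part of \<open>exp V\<close> still running, which the
    next factor \<open>L\<close> multiplies; \<open>B\<close> is the part already frozen, which
    stays.\<close>
  define A where "A = (\<lambda>\<omega>. if h \<le> V \<omega> then 0 else exp (V \<omega>))"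
  define B where "B = (\<lambda>\<omega>. if h \<le> V \<omega> then exp (V \<omega>) else 0)"
  have [measurable]: "V \<in> borel_measurable M" "L \<in> borel_measurable M"
    "A \<in> borel_measurable M" "B \<in> borel_measurable M"
    unfolding V_def L_def A_def B_def by measurable
  have V_int: "integrable M (\<lambda>\<omega>. exp (V \<omega>))"
    using Suc by (simp add: V_def)
  have A_int: "integrable M A" and B_int: "integrable M B"
    by (auto intro!: Bochner_Integration.integrable_bound[OF V_int] simp: A_def B_def)
  have EL: "expectation L = 1" using exp1[of "Suc n"] by (simp add: L_def)
  \<comment> \<open>A non-integrable \<open>L\<close> would have integral \<open>0\<close> rather
    than \<open>1\<close>.\<close>
  have L_int: "integrable M L" using EL not_integrable_integral_eq by fastforce
  have S_int: "integrable M (\<lambda>\<omega>. max (1 - L \<omega>) 0)"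
    using L_int by (intro Bochner_Integration.integrable_max) auto
  have "indep_var borel ((\<lambda>v. if h \<le> v then 0 else exp v) \<circ> V) borel (exp \<circ> Y (Suc n))"
    using indep_var_stopped_cusum[OF indep, of h n]
    unfolding V_def by (rule indep_var_compose) auto
  then have AL_indep: "indep_var borel A borel L"
    by (simp add: A_def L_def comp_def)
  have AL_int: "integrable M (\<lambda>\<omega>. A \<omega> * L \<omega>)"
    by (rule indep_var_integrable[OF AL_indep A_int L_int])
  have AL: "expectation (\<lambda>\<omega>. A \<omega> * L \<omega>) = expectation A"
    using indep_var_lebesgue_integral[OF AL_indep A_int L_int] EL by simp
  have bound: "exp (stopped_cusum h (\<lambda>i. Y i \<omega>) (Suc n)) \<le> A \<omega> * L \<omega> + B \<omega> + max (1 - L \<omega>) 0"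
    for \<omega>
  proof (cases "h \<le> V \<omega>")
    case True
    then show ?thesis by (auto simp: A_def B_def V_def)
  next
    case False
    have "exp (stopped_cusum h (\<lambda>i. Y i \<omega>) (Suc n)) = max (exp (V \<omega>) * L \<omega>) 1"
      using False by (auto simp: V_def L_def max_def simp flip: exp_add)
    also have "\<dots> \<le> exp (V \<omega>) * L \<omega> + max (1 - L \<omega>) 0"
      by (rule max_one_mult_le) (auto simp: V_def L_def stopped_cusum_nonneg)
    finally show ?thesis using False by (simp add: A_def B_def)
  qed
  have R_int: "integrable M (\<lambda>\<omega>. A \<omega> * L \<omega> + B \<omega> + max (1 - L \<omega>) 0)"
    using AL_int B_int S_int by auto
  have int: "integrable M (\<lambda>\<omega>. exp (stopped_cusum h (\<lambda>i. Y i \<omega>) (Suc n)))"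
    using V[of "Suc n"] bound
    by (intro Bochner_Integration.integrable_bound[OF R_int])
      (auto intro: order_trans[OF _ abs_ge_self] simp del: stopped_cusum.simps)
  have "expectation (\<lambda>\<omega>. exp (stopped_cusum h (\<lambda>i. Y i \<omega>) (Suc n)))
      \<le> expectation (\<lambda>\<omega>. A \<omega> * L \<omega> + B \<omega> + max (1 - L \<omega>) 0)"
    by (rule integral_mono[OF int R_int bound])
  \<comment> \<open>Independence and the mean \<open>1\<close> of \<open>L\<close> have removed the
    factor \<open>L\<close>, so the running and frozen parts recombine to
    \<open>exp V\<close>.\<close>
  also have "\<dots> = expectation A + expectation B + expectation (\<lambda>\<omega>. max (1 - L \<omega>) 0)"
    using AL_int B_int S_int AL by simp
  also have "expectation A + expectation B = expectation (\<lambda>\<omega>. A \<omega> + B \<omega>)"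
    using A_int B_int by simp
  also have "(\<lambda>\<omega>. A \<omega> + B \<omega>) = (\<lambda>\<omega>. exp (V \<omega>))"
    by (auto simp: A_def B_def)
  also have "expectation (\<lambda>\<omega>. exp (V \<omega>)) + expectation (\<lambda>\<omega>. max (1 - L \<omega>) 0)
      \<le> (1 + real n * d) + d"
    using Suc defect[of "Suc n"] by (intro add_mono) (auto simp: V_def L_def)
  finally show ?case using int by (simp add: algebra_simps)
qed

lemma prob_Max_cusum_ge:
  fixes Y :: "nat \<Rightarrow> 'a \<Rightarrow> real"
  assumes "indep_vars (\<lambda>_. borel) Y {1..}"
    and "\<And>i. i \<ge> 1 \<Longrightarrow> expectation (\<lambda>\<omega>. exp (Y i \<omega>)) = 1"
    and "\<And>i. i \<ge> 1 \<Longrightarrow> expectation (\<lambda>\<omega>. max (1 - exp (Y i \<omega>)) 0) \<le> d"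
  shows "\<P>(\<omega> in M. (MAX t\<in>{0..n}. cusum (\<lambda>i. Y i \<omega>) t) \<ge> h) \<le> exp (- h) * (1 + real n * d)"
proof -
  note E = expectation_exp_stopped_cusum[OF assms, of h n]
  have "\<P>(\<omega> in M. (MAX t\<in>{0..n}. cusum (\<lambda>i. Y i \<omega>) t) \<ge> h)
      = \<P>(\<omega> in M. exp h \<le> exp (stopped_cusum h (\<lambda>i. Y i \<omega>) n))"
    by (simp add: le_Max_cusum_iff)
  also have "\<dots> \<le> expectation (\<lambda>\<omega>. exp (stopped_cusum h (\<lambda>i. Y i \<omega>) n)) / exp h"
    using E by (intro integral_Markov_inequality_measure[where A = "{}"]) auto
  also have "\<dots> \<le> (1 + real n * d) / exp h"
    using E by (intro divide_right_mono) auto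
  finally show ?thesis by (simp add: exp_minus field_simps)
qed

end

text \<open>Almost surely under \<open>F\<close> the integrand is \<open>1 - g / f\<close> on the
  set where \<open>f > g\<close>, and \<open>0\<close> elsewhere. Integrating \<open>g / f\<close>
  over that set against \<open>F\<close> gives its mass under \<open>G\<close>.\<close>

lemma integral_llr_defect:
  fixes f g :: "'a \<Rightarrow> real"
  assumes [measurable]: "f \<in> borel_measurable \<mu>" "g \<in> borel_measurable \<mu>"
    and f_nonneg: "\<And>x. x \<in> space \<mu> \<Longrightarrow> 0 \<le> f x" and g_nonneg: "\<And>x. x \<in> space \<mu> \<Longrightarrow> 0 \<le> g x"
    and F: "F = density \<mu> (\<lambda>x. ennreal (f x))" "prob_space F"
    and G: "G = density \<mu> (\<lambda>x. ennreal (g x))"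
    and pos: "AE x in F. 0 < f x \<and> 0 < g x"
  shows "(\<integral>x. max (1 - exp (llr f g x)) 0 \<partial>F) = D_FG F G f g"
proof -
  interpret F: prob_space F by (rule F(2))
  let ?A = "{x \<in> space \<mu>. g x < f x}"
  have sp: "space F = space \<mu>" "sets F = sets \<mu>" "space G = space \<mu>" "sets G = sets \<mu>"
    using F(1) G by auto
  have [measurable]: "f \<in> borel_measurable F" "g \<in> borel_measurable F" "?A \<in> sets F" "?A \<in> sets G"
    by (auto simp: F(1) G)
  have 1: "AE x in \<mu>. 0 \<le> f x" and 2: "AE x in \<mu>. 0 \<le> g x"
    using f_nonneg g_nonneg by auto
  have "(\<integral>x. max (1 - exp (llr f g x)) 0 \<partial>F) = (\<integral>x. indicator ?A x - indicator ?A x * (g x / f x) \<partial>F)"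
  proof (intro integral_cong_AE)
    show "AE x in F. max (1 - exp (llr f g x)) 0 = indicator ?A x - indicator ?A x * (g x / f x)"
      using pos AE_space by eventually_elim (auto simp: llr_def sp indicator_def max_def field_simps)
  qed (auto simp: llr_def)
  also have "\<dots> = (\<integral>x. indicator ?A x \<partial>F) - (\<integral>x. indicator ?A x * (g x / f x) \<partial>F)"
  proof (rule Bochner_Integration.integral_diff)
    show "integrable F (indicator ?A :: _ \<Rightarrow> real)" by (simp add: F.emeasure_eq_measure)
    show "integrable F (\<lambda>x. indicator ?A x * (g x / f x))"
    proof (intro F.integrable_const_bound[where B = 1] AE_I2)
      fix x assume "x \<in> space F"
      then have "0 \<le> f x" "0 \<le> g x" by (auto simp: sp f_nonneg g_nonneg)
      then show "norm (indicator ?A x * (g x / f x)) \<le> 1"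
        by (auto simp: indicator_def divide_simps)
    qed measurable
  qed
  also have "(\<integral>x. indicator ?A x * (g x / f x) \<partial>F) = (\<integral>x. f x * (indicator ?A x * (g x / f x)) \<partial>\<mu>)"
    unfolding F(1) using 1 by (subst integral_density) auto
  also have "\<dots> = (\<integral>x. g x * indicator ?A x \<partial>\<mu>)"
  \<comment> \<open>On \<open>?A\<close> the inequality \<open>0 \<le> g x < f x\<close> allows
    cancelling \<open>f x\<close>; off \<open>?A\<close> both sides vanish, even where
    \<open>f x = 0\<close>.\<close>
  proof (intro Bochner_Integration.integral_cong refl)
    fix x assume "x \<in> space \<mu>"
    then show "f x * (indicator ?A x * (g x / f x)) = g x * indicator ?A x"
      using g_nonneg[of x] by (cases "x \<in> ?A") auto
  qed
  also have "\<dots> = (\<integral>x. indicator ?A x \<partial>G)"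
    unfolding G using 2 by (subst integral_density) auto
  finally show ?thesis
    by (simp add: D_FG_def sp)
qed

theorem mainTheorem8:
  fixes \<mu> F G :: "'a measure" and f g :: "'a \<Rightarrow> real"
    and P :: "'w measure" and X :: "nat \<Rightarrow> 'w \<Rightarrow> 'a"
  assumes f_meas: "f \<in> borel_measurable \<mu>" and f_nonneg: "\<forall>x\<in>space \<mu>. 0 \<le> f x"
    and g_meas: "g \<in> borel_measurable \<mu>" and g_nonneg: "\<forall>x\<in>space \<mu>. 0 \<le> g x"
    and F_dens: "F = density \<mu> (\<lambda>x. ennreal (f x))" and F_prob: "prob_space F"
    and G_dens: "G = density \<mu> (\<lambda>x. ennreal (g x))" and G_prob: "prob_space G"
    and llr_well_defined: "AE x in F. 0 < f x \<and> 0 < g x"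
    and P_prob: "prob_space P"
    and X_indep: "prob_space.indep_vars P (\<lambda>_. \<mu>) X {1..}"
    and X_distr: "\<forall>i\<ge>1. distr P \<mu> (X i) = F"
    and exp_llr: "\<forall>i\<ge>1. prob_space.expectation P (\<lambda>\<omega>. exp (llr f g (X i \<omega>))) = 1"
  shows "(\<forall>n\<ge>1. \<forall>h::real.
            \<P>(\<omega> in P. (MAX t\<in>{0..n}. cusum (\<lambda>i. llr f g (X i \<omega>)) t) \<ge> h)
              \<le> exp (- h) * (1 + real n * D_FG F G f g))
       \<and> (\<forall>n\<ge>1. \<forall>\<alpha>::real. 0 < \<alpha> \<and> \<alpha> < 1 \<longrightarrow>
            \<P>(\<omega> in P. (MAX t\<in>{0..n}. cusum (\<lambda>i. llr f g (X i \<omega>)) t)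
                        \<ge> ln ((1 + real n * D_FG F G f g) / \<alpha>))
              \<le> \<alpha>)"
proof -
  interpret P: prob_space P by (rule P_prob)
  note [measurable] = f_meas g_meas
  have llr_meas[measurable]: "llr f g \<in> borel_measurable \<mu>"
    unfolding llr_def by measurable
  have X[measurable]: "X i \<in> measurable P \<mu>" if "i \<ge> 1" for i
    using X_indep that unfolding P.indep_vars_def by auto
  have defect_F: "(\<integral>x. max (1 - exp (llr f g x)) 0 \<partial>F) = D_FG F G f g"
    using f_nonneg g_nonneg
    by (intro integral_llr_defect[OF f_meas g_meas _ _ F_dens F_prob G_dens llr_well_defined])
      auto
  have defect: "P.expectation (\<lambda>\<omega>. max (1 - exp (llr f g (X i \<omega>))) 0) = D_FG F G f g"
    if "i \<ge> 1" for i
    using integral_distr[OF X[OF that], of "\<lambda>x. max (1 - exp (llr f g x)) 0"] X_distr that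
    by (simp add: defect_F)
  have "P.indep_vars (\<lambda>_. borel) (\<lambda>i. llr f g \<circ> X i) {1..}"
    by (rule P.indep_vars_compose[OF X_indep]) simp
  then have bound: "\<P>(\<omega> in P. (MAX t\<in>{0..n}. cusum (\<lambda>i. llr f g (X i \<omega>)) t) \<ge> h)
      \<le> exp (- h) * (1 + real n * D_FG F G f g)" for n h
    using exp_llr defect by (intro P.prob_Max_cusum_ge) (auto simp: comp_def)
  \<comment> \<open>As the mean of a positive part, \<open>D_FG\<close> cannot be negative; hence
    the logarithm in the threshold has a positive argument and \<open>exp\<close> inverts
    it.\<close>
  have "0 \<le> D_FG F G f g"
    unfolding defect_F[symmetric] by (rule Bochner_Integration.integral_nonneg) simp
  then have pos: "0 < 1 + real n * D_FG F G f g" for n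
    by (simp add: add_pos_nonneg)
  have level: "exp (- ln ((1 + real n * D_FG F G f g) / \<alpha>)) * (1 + real n * D_FG F G f g) = \<alpha>"
    if "0 < \<alpha>" for n and \<alpha> :: real
    using pos[of n] that by (simp add: exp_minus)
  show ?thesis
  proof (intro conjI allI impI)
    fix n :: nat and \<alpha> :: real
    assume "0 < \<alpha> \<and> \<alpha> < 1"
    then show "\<P>(\<omega> in P. (MAX t\<in>{0..n}. cusum (\<lambda>i. llr f g (X i \<omega>)) t)
        \<ge> ln ((1 + real n * D_FG F G f g) / \<alpha>)) \<le> \<alpha>"
      using bound[of "ln ((1 + real n * D_FG F G f g) / \<alpha>)" n] level[of \<alpha> n]
      by linarith
  qed (rule bound)
qed

end
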